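(* Let $\mathbf{ALG}$ be an algorithm for the Repeated Prophet Inequality (in either the value-oblivious or the value-observed variant) that does not compare items of Phase 2 to items of Phase 1. Then $\mathrm{perf}(\mathbf{ALG}) \le 1/e$.
   Context: Repeated Prophet Inequality. An adversary chooses $2n$ items with values $v_1 \ge v_2 \ge \dots \ge v_{2n} \ge 0$ (the instance $\bm v$), and $\sigma$ is a uniformly random permutation of $\{1,\dots,2n\}$. In Phase 1 the items $v_{\sigma(1)},\dots,v_{\sigma(n)}$ are presented one by one to a decision maker (DM); in Phase 2 the items $v_{\sigma(n+1)},\dots,v_{\sigma(2n)}$ are presented one by one. When an item arrives, the DM does not see its numerical value but learns its relative ranking among all items revealed to her so far (in both phases; ties are broken by an arbitrary rule, fixed and public in advance, consistent with the relative ranks revealed). She must then irrevocably accept it, which ends the current phase (no more items of that phase are revealed), or reject it forever and proceed to the next item of the phase, if any. If no item is accepted in a phase, she gets value $0$ in that phase. In the value-observed variant the DM knows the list $v_1,\dots,v_{2n}$ in advance (but still only sees relative rankings when items arrive); in the value-oblivious variant she does not. An algorithm is a family $\mathbf{ALG} = (\mathrm{ALG}_n)_{n\in\mathbb{N}}$, where $\mathrm{ALG}_n$ describes how the DM (who knows $n$) acts on instances with $2n$ items; $\mathrm{ALG}_n(\bm v)$ denotes the random sum of the values accepted in the two phases. Its limit performance is $$\mathrm{perf}(\mathbf{ALG}) = \liminf_{n\to\infty} \inf_{\bm v} \frac{\mathbb{E}(\mathrm{ALG}_n(\bm v))}{\mathbb{E}\left(\max\{v_{\sigma(i)} : 1\le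 i\le n\} + \max\{v_{\sigma(i)} : n+1\le i\le 2n\}\right)},$$ the infimum being over instances of $2n$ items for which the ratio is defined (not all values zero). An algorithm does not compare items of Phase 2 to items of Phase 1 if it treats the first $n$ items and the last $n$ items as separate and independent single-selection stopping problems: its decisions in Phase 2 use only the relative rankings of Phase 2 items among the Phase 2 items revealed so far. *)

theory Defs
  imports "HOL-Probability.Probability" "HOL-Combinatorics.Permutations"
begin

text \<open>
  Items, and likewise arrival positions, are numbered \<open>0, \<dots>, 2 n - 1\<close>.  The item at position
  \<open>t\<close> is \<open>\<sigma> t\<close>.  Positions \<open>{..<n}\<close> form Phase 1 and positions \<open>{n..<2 * n}\<close> form Phase 2.
\<close>

definition rpi_instance :: "nat \<Rightarrow> real list \<Rightarrow> bool" where
  "rpi_instance n v \<longleftrightarrow> length v = 2 * n \<and> sorted_wrt (\<ge>) v \<and> (\<forall>x\<in>set v. 0 \<le> x)"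

definition arrival_order :: "nat \<Rightarrow> (nat \<Rightarrow> nat) pmf" where
  "arrival_order n = pmf_of_set {\<sigma>. \<sigma> permutes {..<2 * n}}"

text \<open>
  A ranking is a reflexive linear order on arrival positions; \<open>(s, t) \<in> R\<close> means that the item at
  position \<open>s\<close> ranks at least as high as the one at position \<open>t\<close>.  A tie-breaking rule completes
  the comparison of values to such a linear order.  It is fixed in advance but otherwise
  arbitrary: it may break ties by item label, by time of arrival, or in any other way.
\<close>

type_synonym tie_rule = "real list \<Rightarrow> (nat \<Rightarrow> nat) \<Rightarrow> nat rel"

definition valid_tie_rule :: "tie_rule \<Rightarrow> bool" where
  "valid_tie_rule T \<longleftrightarrow>
    (\<forall>n v \<sigma>. rpi_instance n v \<longrightarrow> \<sigma> permutes {..<2 * n} \<longrightarrow>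
       linear_order_on {..<2 * n} (T v \<sigma>) \<and>
       (\<forall>s<2 * n. \<forall>t<2 * n. v ! \<sigma> s > v ! \<sigma> t \<longrightarrow> (s, t) \<in> T v \<sigma>))"

text \<open>
  All the decision maker has observed at some moment is the ranking restricted to the positions
  revealed so far.  These positions are the field of the restricted relation (it is reflexive), so
  the relation also tells the time, and the item to be decided on is the one at the last revealed
  position.  A deterministic decision rule says whether that item is accepted.  Past decisions need
  not be recorded, since they are determined by the rule and the earlier observations.
\<close>

type_synonym decision_rule = "nat rel \<Rightarrow> bool"

definition first_accepted :: "nat set \<Rightarrow> (nat \<Rightarrow> bool) \<Rightarrow> nat option" where
  "first_accepted P acc =
    (if \<exists>t\<in>P. acc t then Some (LEAST t. t \<in> P \<and> acc t) else None)"

definition phase1_choice :: "nat \<Rightarrow> decision_rule \<Rightarrow> nat rel \<Rightarrow> nat option" where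
  "phase1_choice n d R = first_accepted {..<n} (\<lambda>t. d (Restr R {..t}))"

definition phase1_revealed :: "nat \<Rightarrow> decision_rule \<Rightarrow> nat rel \<Rightarrow> nat set" where
  "phase1_revealed n d R = (case phase1_choice n d R of None \<Rightarrow> {..<n} | Some t \<Rightarrow> {..t})"

definition phase2_choice :: "nat \<Rightarrow> decision_rule \<Rightarrow> nat rel \<Rightarrow> nat option" where
  "phase2_choice n d R =
    first_accepted {n..<2 * n} (\<lambda>t. d (Restr R (phase1_revealed n d R \<union> {n..t})))"

definition accepted_value :: "real list \<Rightarrow> (nat \<Rightarrow> nat) \<Rightarrow> nat option \<Rightarrow> real" where
  "accepted_value v \<sigma> c = (case c of None \<Rightarrow> 0 | Some t \<Rightarrow> v ! \<sigma> t)"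

definition total_value ::
  "tie_rule \<Rightarrow> nat \<Rightarrow> real list \<Rightarrow> decision_rule \<Rightarrow> (nat \<Rightarrow> nat) \<Rightarrow> real" where
  "total_value T n v d \<sigma> =
    accepted_value v \<sigma> (phase1_choice n d (T v \<sigma>)) +
    accepted_value v \<sigma> (phase2_choice n d (T v \<sigma>))"

text \<open>
  Algorithms may be randomized: they draw a deterministic decision rule, independently of the
  arrival order.  Only finitely many rules differ on the observations possible for a given \<open>n\<close>, so
  nothing is lost by using discrete distributions.
\<close>

datatype algorithm =
  Value_Oblivious "nat \<Rightarrow> decision_rule pmf"
| Value_Observed "nat \<Rightarrow> real list \<Rightarrow> decision_rule pmf"

fun rule_distribution :: "algorithm \<Rightarrow> nat \<Rightarrow> real list \<Rightarrow> decision_rule pmf" where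
  "rule_distribution (Value_Oblivious D) n v = D n"
| "rule_distribution (Value_Observed D) n v = D n v"

definition expected_value :: "tie_rule \<Rightarrow> algorithm \<Rightarrow> nat \<Rightarrow> real list \<Rightarrow> real" where
  "expected_value T ALG n v =
    measure_pmf.expectation (pair_pmf (rule_distribution ALG n v) (arrival_order n))
      (\<lambda>(d, \<sigma>). total_value T n v d \<sigma>)"

definition expected_prophet :: "nat \<Rightarrow> real list \<Rightarrow> real" where
  "expected_prophet n v =
    measure_pmf.expectation (arrival_order n)
      (\<lambda>\<sigma>. Max ((\<lambda>i. v ! \<sigma> i) ` {..<n}) + Max ((\<lambda>i. v ! \<sigma> i) ` {n..<2 * n}))"

definition perf :: "tie_rule \<Rightarrow> algorithm \<Rightarrow> ereal" where
  "perf T ALG =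
    liminf (\<lambda>n. INF v \<in> {v. rpi_instance n v \<and> (\<exists>x\<in>set v. x \<noteq> 0)}.
      ereal (expected_value T ALG n v / expected_prophet n v))"

text \<open>
  The observations possible in Phase 2: the first \<open>a\<close> items of Phase 1 and the items at the
  positions \<open>n, \<dots>, b\<close> have been revealed.
\<close>

definition phase2_observation :: "nat \<Rightarrow> nat rel \<Rightarrow> bool" where
  "phase2_observation n R \<longleftrightarrow>
    (\<exists>a b. 1 \<le> a \<and> a \<le> n \<and> n \<le> b \<and> b < 2 * n \<and> linear_order_on ({..<a} \<union> {n..b}) R)"

definition rule_ignores_phase1 :: "nat \<Rightarrow> decision_rule \<Rightarrow> bool" where
  "rule_ignores_phase1 n d \<longleftrightarrow>
    (\<forall>R R'. phase2_observation n R \<longrightarrow> phase2_observation n R' \<longrightarrow>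
       Restr R {n..<2 * n} = Restr R' {n..<2 * n} \<longrightarrow> d R = d R')"

text \<open>
  The two phases may share the random choice of the rule; whatever rule is drawn, its decisions
  in Phase 2 use nothing but the ranking of the Phase 2 items among themselves.
\<close>

definition does_not_compare :: "algorithm \<Rightarrow> bool" where
  "does_not_compare ALG \<longleftrightarrow>
    (\<forall>n v. rpi_instance n v \<longrightarrow>
       (\<forall>d\<in>set_pmf (rule_distribution ALG n v). rule_ignores_phase1 n d))"

end

theory Submission imports Defs "HOL-Real_Asymp.Real_Asymp" begin

text \<open>
  On an instance with one valuable item and tiny distinct other values, all that matters is whether
  the valuable item is accepted; it lies in either phase with probability \<open>1/2\<close>.  A rule that does
  not compare the phases plays the secretary problem in each of them.  Let \<open>q i\<close> be the
  probability that position \<open>i\<close> (counted from \<open>0\<close>) of a phase is accepted and holds the best item of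
  the phase so far.  Being best so far is independent of the earlier relative order, so
  \<open>(i + 1) q i \<le> 1 - (\<Sum>j<i. q j)\<close>; and given the relative order so far, a best item so far is the best
  of all \<open>N = 2 n\<close> items with probability \<open>(i + 1) / N\<close>.  The linear program of maximizing
  \<open>\<Sum>i<n. (i + 1) / n * q i\<close> under these constraints has a value tending to \<open>1/e\<close>.
\<close>

section \<open>Relative order in a random permutation\<close>

text \<open>Encodes that the event \<open>E\<close> can be read off from the relative ranks at the
  positions in \<open>S\<close>. One implication suffices, since the premise is symmetric in
  \<open>\<sigma>\<close> and \<open>\<tau>\<close>. Smaller labels mean better items, label 0 being
  the best.\<close>

definition order_determined :: "nat \<Rightarrow> nat set \<Rightarrow> ((nat \<Rightarrow> nat) \<Rightarrow> bool) \<Rightarrow> bool" where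
  "order_determined N S E \<longleftrightarrow>
    (\<forall>\<sigma> \<tau>. \<sigma> permutes {..<N} \<longrightarrow> \<tau> permutes {..<N} \<longrightarrow>
      (\<forall>s\<in>S. \<forall>t\<in>S. \<sigma> s \<le> \<sigma> t \<longleftrightarrow> \<tau> s \<le> \<tau> t) \<longrightarrow> E \<sigma> \<longrightarrow> E \<tau>)"

lemma order_determinedD:
  assumes "order_determined N S E" "\<sigma> permutes {..<N}" "\<tau> permutes {..<N}"
    and "\<And>s t. s \<in> S \<Longrightarrow> t \<in> S \<Longrightarrow> \<sigma> s \<le> \<sigma> t \<longleftrightarrow> \<tau> s \<le> \<tau> t"
  shows "E \<sigma> \<longleftrightarrow> E \<tau>"
  using assms unfolding order_determined_def by blast

lemma order_determined_mono:
  assumes "order_determined N S E" "S \<subseteq> S'"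
  shows "order_determined N S' E"
  unfolding order_determined_def
  using order_determinedD[OF assms(1)] assms(2) by (meson subsetD)

lemma order_determined_conj:
  assumes "order_determined N S E" "order_determined N S F"
  shows "order_determined N S (\<lambda>\<sigma>. E \<sigma> \<and> F \<sigma>)"
  unfolding order_determined_def
  using order_determinedD[OF assms(1)] order_determinedD[OF assms(2)] by metis

lemma order_determined_not:
  assumes "order_determined N S E"
  shows "order_determined N S (\<lambda>\<sigma>. \<not> E \<sigma>)"
  unfolding order_determined_def
  using order_determinedD[OF assms(1)] by metis

lemma order_determined_all:
  assumes "\<And>i. i \<in> I \<Longrightarrow> order_determined N S (E i)"
  shows "order_determined N S (\<lambda>\<sigma>. \<forall>i\<in>I. E i \<sigma>)"
  unfolding order_determined_def
  using order_determinedD[OF assms] by metis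

lemma order_determined_min:
  assumes "t \<in> S"
  shows "order_determined N S (\<lambda>\<sigma>. \<forall>s\<in>S. \<sigma> t \<le> \<sigma> s)"
  unfolding order_determined_def using assms by blast

text \<open>This is \<open>fact N\<close> times the probability of \<open>E\<close> under a uniform
  permutation. Counting turns independence statements into identities between natural
  numbers.\<close>

definition perm_count :: "nat \<Rightarrow> ((nat \<Rightarrow> nat) \<Rightarrow> bool) \<Rightarrow> nat" where
  "perm_count N E = card {\<sigma>. \<sigma> permutes {..<N} \<and> E \<sigma>}"

lemma finite_perm_Collect [simp]: "finite {\<sigma>. \<sigma> permutes {..<N::nat} \<and> E \<sigma>}"
  by (rule finite_subset[OF _ finite_permutations[of "{..<N}"]]) auto

section \<open>Moving one position through the ranks\<close>

definition rank_in :: "nat set \<Rightarrow> nat \<Rightarrow> (nat \<Rightarrow> nat) \<Rightarrow> nat" where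
  "rank_in S u \<sigma> = card {s \<in> S. \<sigma> s < \<sigma> u}"

definition next_in :: "nat set \<Rightarrow> nat \<Rightarrow> (nat \<Rightarrow> nat) \<Rightarrow> nat \<Rightarrow> bool" where
  "next_in S u \<sigma> s \<longleftrightarrow> s \<in> S \<and> \<sigma> u < \<sigma> s \<and> (\<forall>r\<in>S. \<sigma> u < \<sigma> r \<longrightarrow> \<sigma> s \<le> \<sigma> r)"

definition prev_in :: "nat set \<Rightarrow> nat \<Rightarrow> (nat \<Rightarrow> nat) \<Rightarrow> nat \<Rightarrow> bool" where
  "prev_in S u \<sigma> s \<longleftrightarrow> s \<in> S \<and> \<sigma> s < \<sigma> u \<and> (\<forall>r\<in>S. \<sigma> r < \<sigma> u \<longrightarrow> \<sigma> r \<le> \<sigma> s)"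

lemma next_in_exists:
  assumes "finite S" "u \<notin> S" "inj \<sigma>" "rank_in S u \<sigma> < card S"
  shows "\<exists>s. next_in S u \<sigma> s"
proof -
  have "{s \<in> S. \<sigma> s < \<sigma> u} \<noteq> S"
    using assms(4) unfolding rank_in_def by (metis less_irrefl)
  then obtain s where "s \<in> S" "\<not> \<sigma> s < \<sigma> u"
    by blast
  moreover have "\<sigma> s \<noteq> \<sigma> u"
    using assms(2,3) \<open>s \<in> S\<close> by (auto dest: injD)
  ultimately have "s \<in> S \<and> \<sigma> u < \<sigma> s"
    by simp
  then show ?thesis
    using ex_has_least_nat[of "\<lambda>s. s \<in> S \<and> \<sigma> u < \<sigma> s" s \<sigma>] unfolding next_in_def by blast
qed

lemma prev_in_exists:
  assumes "finite S" "0 < rank_in S u \<sigma>"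
  shows "\<exists>s. prev_in S u \<sigma> s"
proof -
  let ?A = "{s \<in> S. \<sigma> s < \<sigma> u}"
  have A: "finite ?A" "?A \<noteq> {}"
    using assms by (auto simp: rank_in_def card_gt_0_iff)
  then have "Max (\<sigma> ` ?A) \<in> \<sigma> ` ?A"
    by (intro Max_in) auto
  then obtain s where "s \<in> ?A" "\<sigma> s = Max (\<sigma> ` ?A)"
    by fastforce
  then show ?thesis
    using A unfolding prev_in_def by (intro exI[of _ s]) auto
qed

text \<open>The exchange gives \<open>s\<close> the old value of \<open>u\<close>. No value on
  \<open>S\<close> lies strictly between the two, so all comparisons inside \<open>S\<close>
  survive, and \<open>u\<close> overtakes exactly one element, namely \<open>s\<close>. The claim on
  \<open>prev_in\<close> is what makes the exchange reversible.\<close>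

lemma transpose_next:
  assumes "u \<notin> S" "inj \<sigma>" "next_in S u \<sigma> s" "\<tau> = \<sigma> \<circ> Transposition.transpose u s"
  shows "prev_in S u \<tau> s"
    and "r \<in> S \<Longrightarrow> t \<in> S \<Longrightarrow> \<tau> r \<le> \<tau> t \<longleftrightarrow> \<sigma> r \<le> \<sigma> t"
    and "finite S \<Longrightarrow> rank_in S u \<tau> = Suc (rank_in S u \<sigma>)"
proof -
  have s: "s \<in> S" "\<sigma> u < \<sigma> s" "\<And>r. r \<in> S \<Longrightarrow> \<sigma> u < \<sigma> r \<Longrightarrow> \<sigma> s \<le> \<sigma> r"
    using assms(3) by (auto simp: next_in_def)
  have \<tau>: "\<tau> u = \<sigma> s" "\<tau> s = \<sigma> u" "\<And>r. r \<in> S \<Longrightarrow> r \<noteq> s \<Longrightarrow> \<tau> r = \<sigma> r"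
    using assms(1,4) by (auto simp: Transposition.transpose_def)
  have neq: "\<sigma> r \<noteq> \<sigma> u" if "r \<in> S" for r
    using that assms(1,2) by (auto dest: injD)
  have neqs: "\<sigma> r \<noteq> \<sigma> s" if "r \<noteq> s" for r
    using that assms(2) by (auto dest: injD)
  \<comment> \<open>By the minimality of \<open>s\<close>, no value on \<open>S\<close> lies
    strictly between \<open>\<sigma> u\<close> and \<open>\<sigma> s\<close>, so comparing with
    either gives the same answer.\<close>
  have cmp: "\<sigma> r < \<sigma> u \<longleftrightarrow> \<sigma> r < \<sigma> s" if "r \<in> S" "r \<noteq> s" for r
    using s(2) s(3)[OF that(1)] neq[OF that(1)] by linarith
  show "prev_in S u \<tau> s"
    unfolding prev_in_def using s \<tau> cmp by (metis less_le_not_le linorder_le_less_linear)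
  show "\<tau> r \<le> \<tau> t \<longleftrightarrow> \<sigma> r \<le> \<sigma> t" if "r \<in> S" "t \<in> S"
  proof -
    consider "r = s" "t = s" | "r = s" "t \<noteq> s" | "r \<noteq> s" "t = s" | "r \<noteq> s" "t \<noteq> s"
      by blast
    then show ?thesis
    proof cases
      case 2
      then show ?thesis
        using that \<tau> cmp[of t] neq[of t] neqs[of t] by (metis linorder_le_less_linear not_le)
    next
      case 3
      then show ?thesis
        using that \<tau> cmp[of r] neq[of r] neqs[of r] by (metis order.order_iff_strict)
    qed (use that \<tau> in auto)
  qed
  show "rank_in S u \<tau> = Suc (rank_in S u \<sigma>)" if "finite S"
  proof -
    have "{r \<in> S. \<tau> r < \<tau> u} = insert s {r \<in> S. \<sigma> r < \<sigma> u}"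
      using s \<tau> cmp by (auto, metis)
    moreover have "s \<notin> {r \<in> S. \<sigma> r < \<sigma> u}"
      using s(2) by simp
    ultimately show ?thesis
      using that unfolding rank_in_def by simp
  qed
qed

text \<open>Only the neighbour relation is needed: a transposition is an involution, so the effects
  on order and rank follow from \<open>transpose_next\<close> applied to
  \<open>\<tau>\<close>.\<close>

lemma transpose_prev:
  assumes "u \<notin> S" "inj \<sigma>" "prev_in S u \<sigma> s" "\<tau> = \<sigma> \<circ> Transposition.transpose u s"
  shows "next_in S u \<tau> s"
proof -
  have s: "s \<in> S" "\<sigma> s < \<sigma> u" "\<And>r. r \<in> S \<Longrightarrow> \<sigma> r < \<sigma> u \<Longrightarrow> \<sigma> r \<le> \<sigma> s"
    using assms(3) by (auto simp: prev_in_def)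
  have \<tau>: "\<tau> u = \<sigma> s" "\<tau> s = \<sigma> u" "\<And>r. r \<in> S \<Longrightarrow> r \<noteq> s \<Longrightarrow> \<tau> r = \<sigma> r"
    using assms(1,4) by (auto simp: Transposition.transpose_def)
  show ?thesis
    unfolding next_in_def
  proof (intro conjI ballI impI)
    fix r assume r: "r \<in> S" "\<tau> u < \<tau> r"
    show "\<tau> s \<le> \<tau> r"
    proof (cases "r = s")
      case False
      then have "\<sigma> s < \<sigma> r"
        using r \<tau> by simp
      then have "\<not> \<sigma> r < \<sigma> u"
        using s(3)[OF r(1)] by linarith
      then show ?thesis
        using r \<tau> False by simp
    qed simp
  qed (use s \<tau> in auto)
qed

lemma next_in_unique:
  "inj \<sigma> \<Longrightarrow> next_in S u \<sigma> s \<Longrightarrow> next_in S u \<sigma> s' \<Longrightarrow> s = s'"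
  unfolding next_in_def inj_def by (metis antisym)

lemma prev_in_unique:
  "inj \<sigma> \<Longrightarrow> prev_in S u \<sigma> s \<Longrightarrow> prev_in S u \<sigma> s' \<Longrightarrow> s = s'"
  unfolding prev_in_def inj_def by (metis antisym)

text \<open>
  Exchanging the value at \<open>u\<close> with the next larger value on \<open>S\<close> raises the rank of \<open>u\<close> by one and does
  not disturb the relative order on \<open>S\<close>.
\<close>

lemma perm_count_rank_Suc:
  assumes E: "order_determined N S E" and S: "S \<subseteq> {..<N}" and u: "u < N" "u \<notin> S"
    and j: "j < card S"
  shows "perm_count N (\<lambda>\<sigma>. E \<sigma> \<and> rank_in S u \<sigma> = Suc j) =
         perm_count N (\<lambda>\<sigma>. E \<sigma> \<and> rank_in S u \<sigma> = j)"
proof -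
  have fin: "finite S"
    using S finite_subset by blast
  \<comment> \<open>\<open>f\<close> and \<open>g\<close> are the two mutually inverse exchanges. On
    the sets \<open>?A\<close> and \<open>?B\<close> below, the neighbour picked by
    \<open>SOME\<close> exists by the rank condition and is unique by injectivity.\<close>
  define f where "f \<sigma> = \<sigma> \<circ> Transposition.transpose u (SOME s. next_in S u \<sigma> s)" for \<sigma> :: "nat \<Rightarrow> nat"
  define g where "g \<sigma> = \<sigma> \<circ> Transposition.transpose u (SOME s. prev_in S u \<sigma> s)" for \<sigma> :: "nat \<Rightarrow> nat"
  have f_eq: "f \<sigma> = \<sigma> \<circ> Transposition.transpose u s"
    if "inj \<sigma>" "next_in S u \<sigma> s" for \<sigma> s
    unfolding f_def using next_in_unique[OF that(1)] that(2) by (metis someI)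
  have g_eq: "g \<sigma> = \<sigma> \<circ> Transposition.transpose u s"
    if "inj \<sigma>" "prev_in S u \<sigma> s" for \<sigma> s
    unfolding g_def using prev_in_unique[OF that(1)] that(2) by (metis someI)
  have tr: "\<sigma> \<circ> Transposition.transpose u s permutes {..<N}"
    if "\<sigma> permutes {..<N}" "s \<in> S" for \<sigma> s
    using that S u by (intro permutes_compose permutes_swap_id) auto
  let ?A = "{\<sigma>. \<sigma> permutes {..<N} \<and> E \<sigma> \<and> rank_in S u \<sigma> = j}"
  let ?B = "{\<sigma>. \<sigma> permutes {..<N} \<and> E \<sigma> \<and> rank_in S u \<sigma> = Suc j}"
  have up: "f \<sigma> \<in> ?B \<and> g (f \<sigma>) = \<sigma>" if "\<sigma> \<in> ?A" for \<sigma>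
  proof -
    have \<sigma>: "\<sigma> permutes {..<N}" "E \<sigma>" "rank_in S u \<sigma> = j" "inj \<sigma>"
      using that permutes_inj by auto
    obtain s where s: "next_in S u \<sigma> s"
      using next_in_exists[OF fin u(2) \<sigma>(4)] \<sigma>(3) j by auto
    define \<tau> where "\<tau> = \<sigma> \<circ> Transposition.transpose u s"
    note * = transpose_next[OF u(2) \<sigma>(4) s \<tau>_def]
    have \<tau>: "\<tau> permutes {..<N}"
      unfolding \<tau>_def using s by (intro tr \<sigma>) (simp add: next_in_def)
    have "E \<tau>"
      using order_determinedD[OF E \<tau> \<sigma>(1) *(2)] \<sigma>(2) by blast
    moreover have "f \<sigma> = \<tau>"
      unfolding \<tau>_def by (rule f_eq[OF \<sigma>(4) s])
    moreover have "g \<tau> = \<sigma>"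
      using g_eq[OF permutes_inj[OF \<tau>] *(1)] unfolding \<tau>_def by (simp add: comp_assoc)
    ultimately show ?thesis
      using \<tau> *(3)[OF fin] \<sigma>(3) by auto
  qed
  have down: "g \<sigma> \<in> ?A \<and> f (g \<sigma>) = \<sigma>" if "\<sigma> \<in> ?B" for \<sigma>
  proof -
    have \<sigma>: "\<sigma> permutes {..<N}" "E \<sigma>" "rank_in S u \<sigma> = Suc j" "inj \<sigma>"
      using that permutes_inj by auto
    obtain s where s: "prev_in S u \<sigma> s"
      using prev_in_exists[OF fin, of u \<sigma>] \<sigma>(3) by auto
    define \<tau> where "\<tau> = \<sigma> \<circ> Transposition.transpose u s"
    have next_s: "next_in S u \<tau> s"
      by (rule transpose_prev[OF u(2) \<sigma>(4) s \<tau>_def])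
    have \<tau>: "\<tau> permutes {..<N}"
      unfolding \<tau>_def using s by (intro tr \<sigma>) (simp add: prev_in_def)
    \<comment> \<open>The same transposition leads back from \<open>\<tau>\<close> to
      \<open>\<sigma>\<close>, so \<open>transpose_next\<close> applies with the roles
      exchanged.\<close>
    have inv: "\<sigma> = \<tau> \<circ> Transposition.transpose u s"
      unfolding \<tau>_def by (simp add: comp_assoc)
    note * = transpose_next[OF u(2) permutes_inj[OF \<tau>] next_s inv]
    have "E \<tau>"
      using order_determinedD[OF E \<sigma>(1) \<tau> *(2)] \<sigma>(2) by blast
    moreover have "g \<sigma> = \<tau>"
      unfolding \<tau>_def by (rule g_eq[OF \<sigma>(4) s])
    moreover have "f \<tau> = \<sigma>"
      using f_eq[OF permutes_inj[OF \<tau>] next_s] inv by simp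
    ultimately show ?thesis
      using \<tau> *(3)[OF fin] \<sigma>(3) by auto
  qed
  have "bij_betw f ?A ?B"
    by (rule bij_betw_byWitness[where f' = g]) (use up down in auto)
  then show ?thesis
    unfolding perm_count_def by (simp add: bij_betw_same_card)
qed

text \<open>Given the order on \<open>S\<close>, each of the \<open>card S + 1\<close> possible
  ranks of \<open>u\<close> is equally likely. Hence being a new minimum has probability
  \<open>1 / (card S + 1)\<close> and is independent of \<open>E\<close>.\<close>

lemma perm_count_new_min:
  assumes E: "order_determined N S E" and S: "S \<subseteq> {..<N}" and u: "u < N" "u \<notin> S"
  shows "(card S + 1) * perm_count N (\<lambda>\<sigma>. E \<sigma> \<and> (\<forall>s\<in>S. \<sigma> u < \<sigma> s)) = perm_count N E"
proof -
  have fin: "finite S"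
    using S finite_subset by blast
  have same: "perm_count N (\<lambda>\<sigma>. E \<sigma> \<and> rank_in S u \<sigma> = j) =
      perm_count N (\<lambda>\<sigma>. E \<sigma> \<and> rank_in S u \<sigma> = 0)" if "j \<le> card S" for j
    using that by (induction j) (simp_all add: perm_count_rank_Suc[OF E S u])
  have "rank_in S u \<sigma> \<le> card S" for \<sigma>
    unfolding rank_in_def by (rule card_mono[OF fin]) auto
  then have split: "{\<sigma>. \<sigma> permutes {..<N} \<and> E \<sigma>} =
      (\<Union>j\<in>{..card S}. {\<sigma>. \<sigma> permutes {..<N} \<and> E \<sigma> \<and> rank_in S u \<sigma> = j})"
    by auto
  have "perm_count N E = (\<Sum>j\<le>card S. perm_count N (\<lambda>\<sigma>. E \<sigma> \<and> rank_in S u \<sigma> = j))"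
    unfolding perm_count_def split
    by (rule card_UN_disjoint) (simp_all add: disjoint_iff)
  also have "\<dots> = (\<Sum>j\<le>card S. perm_count N (\<lambda>\<sigma>. E \<sigma> \<and> rank_in S u \<sigma> = 0))"
    by (intro sum.cong refl same) simp
  also have "\<dots> = (card S + 1) * perm_count N (\<lambda>\<sigma>. E \<sigma> \<and> rank_in S u \<sigma> = 0)"
    by simp
  also have "perm_count N (\<lambda>\<sigma>. E \<sigma> \<and> rank_in S u \<sigma> = 0) =
      perm_count N (\<lambda>\<sigma>. E \<sigma> \<and> (\<forall>s\<in>S. \<sigma> u < \<sigma> s))"
  proof -
    have "rank_in S u \<sigma> = 0 \<longleftrightarrow> (\<forall>s\<in>S. \<sigma> u < \<sigma> s)" if "\<sigma> permutes {..<N}" for \<sigma>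
    proof -
      have "\<sigma> s \<noteq> \<sigma> u" if "s \<in> S" for s
        using permutes_inj[OF \<open>\<sigma> permutes {..<N}\<close>] that u(2) by (auto dest: injD)
      then show ?thesis
        using fin unfolding rank_in_def by (auto simp: linorder_neq_iff)
    qed
    then show ?thesis
      unfolding perm_count_def by (intro arg_cong[where f = card]) auto
  qed
  finally show ?thesis by simp
qed

text \<open>Add the positions of \<open>A\<close> one at a time. When \<open>k\<close> positions are
  present, \<open>t\<close> stays the minimum unless the new one is a new minimum, so the count
  shrinks by the factor \<open>k / (k + 1)\<close>. These factors telescope to
  \<open>card S / card (S \<union> A)\<close>.\<close>

lemma perm_count_remains_min:
  assumes F: "order_determined N S F" and S: "S \<subseteq> {..<N}" and t: "t \<in> S"
    and A: "A \<subseteq> {..<N}" "A \<inter> S = {}"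
  shows "card (S \<union> A) * perm_count N (\<lambda>\<sigma>. F \<sigma> \<and> (\<forall>s\<in>S \<union> A. \<sigma> t \<le> \<sigma> s)) =
         card S * perm_count N (\<lambda>\<sigma>. F \<sigma> \<and> (\<forall>s\<in>S. \<sigma> t \<le> \<sigma> s))"
proof -
  have "finite A"
    using A finite_subset by blast
  then show ?thesis
    using A
  proof (induction A rule: finite_induct)
    case (insert u A)
    let ?G = "\<lambda>\<sigma>. F \<sigma> \<and> (\<forall>s\<in>S \<union> A. \<sigma> t \<le> \<sigma> s)"
    have SA: "S \<union> A \<subseteq> {..<N}" "u < N" "u \<notin> S \<union> A" "finite (S \<union> A)" "t \<in> S \<union> A"
      using S insert t finite_subset[OF S] by auto
    \<comment> \<open>The induction relies on the whole event so far being determined by the order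
      on the enlarged set, which lets \<open>perm_count_new_min\<close> apply to it.\<close>
    have G: "order_determined N (S \<union> A) ?G"
      by (intro order_determined_conj order_determined_min SA order_determined_mono[OF F]) auto
    have eq: "{\<sigma>. \<sigma> permutes {..<N} \<and> F \<sigma> \<and> (\<forall>s\<in>S \<union> insert u A. \<sigma> t \<le> \<sigma> s)} =
        {\<sigma>. \<sigma> permutes {..<N} \<and> ?G \<sigma>} -
        {\<sigma>. \<sigma> permutes {..<N} \<and> ?G \<sigma> \<and> (\<forall>s\<in>S \<union> A. \<sigma> u < \<sigma> s)}"
    proof -
      have "(\<forall>s\<in>S \<union> insert u A. \<sigma> t \<le> \<sigma> s) \<longleftrightarrow>
          (\<forall>s\<in>S \<union> A. \<sigma> t \<le> \<sigma> s) \<and> \<not> (\<forall>s\<in>S \<union> A. \<sigma> u < \<sigma> s)" for \<sigma> :: "nat \<Rightarrow> nat"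
      proof -
        have "\<sigma> t \<le> \<sigma> u \<longleftrightarrow> \<not> (\<forall>s\<in>S \<union> A. \<sigma> u < \<sigma> s)"
          if "\<forall>s\<in>S \<union> A. \<sigma> t \<le> \<sigma> s"
        proof
          assume "\<sigma> t \<le> \<sigma> u"
          then show "\<not> (\<forall>s\<in>S \<union> A. \<sigma> u < \<sigma> s)"
            using SA(5) by (meson leD)
        next
          assume "\<not> (\<forall>s\<in>S \<union> A. \<sigma> u < \<sigma> s)"
          then obtain s where s: "s \<in> S \<union> A" "\<sigma> s \<le> \<sigma> u"
            by (meson not_le)
          then show "\<sigma> t \<le> \<sigma> u"
            using bspec[OF that s(1)] by linarith
        qed
        then show ?thesis by auto
      qed
      then show ?thesis by auto
    qed
    have sub: "{\<sigma>. \<sigma> permutes {..<N} \<and> ?G \<sigma> \<and> (\<forall>s\<in>S \<union> A. \<sigma> u < \<sigma> s)} \<subseteq>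
        {\<sigma>. \<sigma> permutes {..<N} \<and> ?G \<sigma>}"
      by auto
    have "perm_count N (\<lambda>\<sigma>. F \<sigma> \<and> (\<forall>s\<in>S \<union> insert u A. \<sigma> t \<le> \<sigma> s)) =
        perm_count N ?G - perm_count N (\<lambda>\<sigma>. ?G \<sigma> \<and> (\<forall>s\<in>S \<union> A. \<sigma> u < \<sigma> s))"
      unfolding perm_count_def eq by (rule card_Diff_subset[OF finite_perm_Collect sub])
    moreover have "card (S \<union> insert u A) = card (S \<union> A) + 1"
      using SA by simp
    ultimately have "card (S \<union> insert u A) *
          perm_count N (\<lambda>\<sigma>. F \<sigma> \<and> (\<forall>s\<in>S \<union> insert u A. \<sigma> t \<le> \<sigma> s)) =
        (card (S \<union> A) + 1) * perm_count N ?G -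
        (card (S \<union> A) + 1) * perm_count N (\<lambda>\<sigma>. ?G \<sigma> \<and> (\<forall>s\<in>S \<union> A. \<sigma> u < \<sigma> s))"
      by (simp add: diff_mult_distrib2)
    also have "\<dots> = card (S \<union> A) * perm_count N ?G"
      using perm_count_new_min[OF G SA(1-3)] by simp
    finally show ?case
      using insert by simp
  qed simp
qed

text \<open>Take \<open>A\<close> to be all remaining positions: a minimum over all positions is
  item 0. So a best item so far, after \<open>card S\<close> positions, is the best overall with
  probability \<open>card S / N\<close>, whatever \<open>F\<close> is.\<close>

lemma perm_count_top:
  assumes F: "order_determined N S F" and S: "S \<subseteq> {..<N}" and t: "t \<in> S"
  shows "N * perm_count N (\<lambda>\<sigma>. F \<sigma> \<and> \<sigma> t = 0) =
         card S * perm_count N (\<lambda>\<sigma>. F \<sigma> \<and> (\<forall>s\<in>S. \<sigma> t \<le> \<sigma> s))"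
proof -
  have top: "(\<forall>s\<in>{..<N}. \<sigma> t \<le> \<sigma> s) \<longleftrightarrow> \<sigma> t = 0" if "\<sigma> permutes {..<N}" for \<sigma>
  proof -
    have "0 < N"
      using S t by auto
    then have "0 \<in> \<sigma> ` {..<N}"
      using permutes_image[OF that] by simp
    then obtain r where "r < N" "\<sigma> r = 0"
      by auto
    then show ?thesis
      by (metis le_zero_eq lessThan_iff zero_le)
  qed
  have "S \<union> ({..<N} - S) = {..<N}"
    using S by auto
  then have "N * perm_count N (\<lambda>\<sigma>. F \<sigma> \<and> (\<forall>s\<in>{..<N}. \<sigma> t \<le> \<sigma> s)) =
         card S * perm_count N (\<lambda>\<sigma>. F \<sigma> \<and> (\<forall>s\<in>S. \<sigma> t \<le> \<sigma> s))"
    using perm_count_remains_min[OF F S t, of "{..<N} - S"] by auto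
  moreover have "perm_count N (\<lambda>\<sigma>. F \<sigma> \<and> (\<forall>s\<in>{..<N}. \<sigma> t \<le> \<sigma> s)) =
      perm_count N (\<lambda>\<sigma>. F \<sigma> \<and> \<sigma> t = 0)"
    unfolding perm_count_def by (intro arg_cong[where f = card]) (use top in auto)
  ultimately show ?thesis by simp
qed

section \<open>The linear program of the secretary problem\<close>

text \<open>
  The assumptions on \<open>h\<close> say that it dominates the optimal continuation value per unit of
  probability \<open>1 - (\<Sum>j<i. q j)\<close> left: they correspond to the extreme choices \<open>q i = 0\<close> and
  \<open>q i = (1 - (\<Sum>j<i. q j)) / (i + 1)\<close>.
\<close>

lemma secretary_lp_bound:
  fixes q h :: "nat \<Rightarrow> real"
  assumes q0: "\<And>i. i < n \<Longrightarrow> 0 \<le> q i"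
    and q: "\<And>i. i < n \<Longrightarrow> real (i + 1) * q i \<le> 1 - (\<Sum>j<i. q j)"
    and hn: "0 \<le> h n"
    and h1: "\<And>i. i < n \<Longrightarrow> h (Suc i) \<le> h i"
    and h2: "\<And>i. i < n \<Longrightarrow> h (Suc i) * (real i / real (i + 1)) + 1 / n \<le> h i"
  shows "(\<Sum>i<n. real (i + 1) / n * q i) \<le> h 0"
proof -
  have u: "0 \<le> 1 - (\<Sum>j<i. q j)" if "i \<le> n" for i
  proof (cases i)
    case (Suc k)
    have "q k \<le> real (k + 1) * q k"
      using q0[of k] Suc that by (simp add: algebra_simps)
    then show ?thesis
      using q[of k] Suc that by simp
  qed simp
  \<comment> \<open>Backward induction: the gain still obtainable from \<open>i\<close> on is at
    most the probability left times \<open>h i\<close>.\<close>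
  have "(\<Sum>j=i..<n. real (j + 1) / n * q j) \<le> (1 - (\<Sum>j<i. q j)) * h i" if "i \<le> n" for i
    using that
  proof (induction i rule: inc_induct)
    case base
    then show ?case using u[of n] hn by simp
  next
    case (step i)
    define w where "w = 1 - (\<Sum>j<i. q j)"
    have i: "i < n" using step by simp
    have w: "0 \<le> w" "real (i + 1) * q i \<le> w"
      using u[of i] q[OF i] i by (auto simp: w_def)
    have "(\<Sum>j=i..<n. real (j + 1) / n * q j) = real (i + 1) / n * q i + (\<Sum>j=Suc i..<n. real (j + 1) / n * q j)"
      using i by (simp add: sum.atLeast_Suc_lessThan)
    also have "\<dots> \<le> real (i + 1) / n * q i + (w - q i) * h (Suc i)"
      using step.IH by (simp add: w_def algebra_simps)
    \<comment> \<open>The mass \<open>w\<close> is split in two. The part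
      \<open>w - (i + 1) * q i\<close> passes on unchanged, as if \<open>q i\<close> were 0; the
      part \<open>(i + 1) * q i\<close> uses its constraint fully, losing the fraction
      \<open>1 / (i + 1)\<close> and gaining \<open>1 / n\<close> per unit. \<open>h1\<close> and
      \<open>h2\<close> bound the two parts.\<close>
    also have "\<dots> = (w - (i + 1) * q i) * h (Suc i) +
        (i + 1) * q i * (h (Suc i) * (real i / real (i + 1)) + 1 / n)"
    proof -
      have "real (i + 1) * q i * (h (Suc i) * (real i / real (i + 1))) = i * q i * h (Suc i)"
        by simp
      then show ?thesis
        by (simp add: algebra_simps add_divide_distrib)
    qed
    also have "\<dots> \<le> (w - (i + 1) * q i) * h i + (i + 1) * q i * h i"
      using w q0[OF i] by (intro add_mono mult_left_mono h1[OF i] h2[OF i]) simp_all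
    also have "\<dots> = w * h i"
      by (simp add: algebra_simps)
    finally show ?case
      by (simp add: w_def)
  qed
  from this[of 0] show ?thesis
    by (simp add: atLeast0LessThan)
qed


text \<open>
  In the limit, the continuation value at time \<open>x = i / n\<close> is \<open>- x ln x\<close> for \<open>x \<ge> 1/e\<close> and the constant
  \<open>1/e\<close> before; \<open>h\<close> below is a discrete upper bound of it.
\<close>

lemma secretary_lp:
  fixes q :: "nat \<Rightarrow> real"
  assumes n: "3 \<le> n"
    and q0: "\<And>i. i < n \<Longrightarrow> 0 \<le> q i"
    and q: "\<And>i. i < n \<Longrightarrow> real (i + 1) * q i \<le> 1 - (\<Sum>j<i. q j)"
  shows "(\<Sum>i<n. real (i + 1) / n * q i) \<le> 1 / exp 1 + 2 / (real n - 1)"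
proof -
  \<comment> \<open>The exact continuation value after the threshold is \<open>i / n\<close> times
    the sum of \<open>1 / j\<close> over \<open>i \<le> j < n\<close>. That sum is at most the
    integral of \<open>1 / x\<close> from \<open>i - 1\<close> to \<open>n - 1\<close>, which is
    \<open>ln (M / (real i - 1))\<close>; hence the shift by one in \<open>M\<close>,
    \<open>good\<close> and \<open>h\<close>.\<close>
  define M where "M = real n - 1"
  define B where "B = 1 / exp 1 + 2 / M"
  have M: "2 \<le> M" "real n = M + 1"
    using n by (auto simp: M_def)
  define good where "good i \<longleftrightarrow> M / exp 1 \<le> real i - 1" for i :: nat
  define h where "h i = (if good i then i / n * ln (M / (real i - 1)) else B)" for i :: nat
  have good_pos: "0 < real i - 1" if "good i" for i
    using that M unfolding good_def by (smt (verit) divide_pos_pos exp_gt_zero)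
  have h_le: "h i \<le> B" if "i \<le> n" for i
  proof (cases "good i")
    case True
    define x where "x = real i - 1"
    have x: "0 < x" "M / exp 1 \<le> x" "x \<le> M" "real i = x + 1"
      using good_pos[OF True] True that M unfolding x_def good_def by auto
    \<comment> \<open>The tangent of the logarithm at \<open>exp 1\<close> gives
      \<open>ln y \<le> y / exp 1\<close>, which is the bound of \<open>- x ln x\<close> by
      \<open>1/e\<close> in disguise. Replacing \<open>M + 1\<close> by \<open>M\<close> then costs
      at most \<open>1 / M\<close>, because \<open>x * exp 1 \<ge> M\<close>.\<close>
    have "ln (M / x) = 1 + ln (M / x / exp 1)"
      using x M by (simp add: ln_div ln_mult)
    also have "\<dots> \<le> M / x / exp 1"
      using ln_le_minus_one[of "M / x / exp 1"] x M by simp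
    finally have ln_le: "ln (M / x) \<le> M / x / exp 1" .
    have "h i = (x + 1) / (M + 1) * ln (M / x)"
      using True x M unfolding h_def x_def[symmetric] by simp
    also have "\<dots> \<le> (x + 1) / (M + 1) * (M / x / exp 1)"
      using x M by (intro mult_left_mono ln_le) simp
    also have "\<dots> \<le> (x + 1) / M * (M / x / exp 1)"
      using x M by (intro mult_right_mono divide_left_mono) auto
    also have "\<dots> = 1 / exp 1 + 1 / (x * exp 1)"
      using x M by (simp add: field_simps)
    also have "\<dots> \<le> 1 / exp 1 + 1 / M"
      using x M by (intro add_left_mono divide_left_mono) (auto simp: field_simps)
    also have "\<dots> \<le> B"
      using M by (simp add: B_def divide_right_mono)
    finally show ?thesis .
  qed (simp add: h_def)
  have step: "h (Suc i) \<le> h i \<and> h (Suc i) * (real i / real (i + 1)) + 1 / n \<le> h i"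
    if i: "i < n" for i
  proof (cases "good i")
    case True
    then have good_Suc: "good (Suc i)"
      unfolding good_def by simp
    \<comment> \<open>The bound \<open>ln (1 - 1 / i) \<le> - 1 / i\<close> yields the inequality
      for accepting. Since \<open>z \<le> 1\<close> past the threshold, that inequality also implies
      that \<open>h\<close> does not increase.\<close>
    define z where "z = ln (M / i)"
    have pos: "1 < real i" "M / exp 1 \<le> real i"
      using good_pos[OF True] True unfolding good_def by auto
    have "M / i \<le> exp 1"
      using pos by (simp add: field_simps)
    then have "ln (M / i) \<le> ln (exp 1)"
      using M pos by (subst ln_le_cancel_iff) auto
    then have "z \<le> 1"
      by (simp add: z_def)
    have hS: "h (Suc i) = (i + 1) / n * z"
      using good_Suc unfolding h_def z_def by simp
    have "ln (M / (real i - 1)) = z - ln (1 - 1 / i)"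
    proof -
      have "1 - 1 / i = (real i - 1) / i"
        using pos by (simp add: field_simps)
      then show ?thesis
        using pos M by (simp add: z_def ln_div)
    qed
    moreover have "ln (1 - 1 / i) \<le> - 1 / i"
      using ln_le_minus_one[of "1 - 1 / i"] pos by (simp add: field_simps)
    ultimately have "z + 1 / i \<le> ln (M / (real i - 1))"
      by simp
    then have "i / n * (z + 1 / i) \<le> i / n * ln (M / (real i - 1))"
      by (rule mult_left_mono) simp
    also have "\<dots> = h i"
      using True by (simp add: h_def)
    also have "i / n * (z + 1 / i) = i / n * z + 1 / n"
      using pos by (simp add: distrib_left)
    finally have "i / n * z + 1 / n \<le> h i" .
    moreover have "h (Suc i) * (real i / real (i + 1)) = i / n * z"
    proof -
      have "x / n * z * (y / x) = y / n * z" if "x \<noteq> 0" for x y :: real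
        using that by simp
      from this[of "real (i + 1)" "real i"] show ?thesis
        unfolding hS by simp
    qed
    moreover have "h (Suc i) = i / n * z + z / n"
      unfolding hS by (simp add: add_divide_distrib distrib_right)
    moreover have "z / n \<le> 1 / n"
      using \<open>z \<le> 1\<close> by (rule divide_right_mono) simp
    ultimately show ?thesis
      by linarith
  next
    case False
    \<comment> \<open>Before the threshold \<open>real i - 1 < M / exp 1\<close>. Passing from
      \<open>i - 1\<close> to \<open>i + 1\<close> adds 2, which is the source of the error term
      \<open>2 / M\<close> in \<open>B\<close>.\<close>
    have "(real i + 1) / n \<le> (M / exp 1 + 2) / (M + 1)"
      using False M unfolding good_def by (simp add: divide_right_mono)
    also have "\<dots> \<le> (M / exp 1 + 2) / M"
      using M by (intro divide_left_mono) auto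
    also have "\<dots> = B"
      using M by (simp add: B_def field_simps)
    finally have "1 / n \<le> B / (real i + 1)"
      using i by (simp add: field_simps)
    moreover have "h (Suc i) * (real i / real (i + 1)) \<le> B * (real i / real (i + 1))"
      using h_le[of "Suc i"] i by (intro mult_right_mono) auto
    moreover have "B * (real i / real (i + 1)) + B / (real i + 1) = B"
    proof -
      have "B * (y / x) + B / x = B * ((y + 1) / x)" for x y :: real
        by (simp add: distrib_left add_divide_distrib)
      from this[of "real i" "real (i + 1)"] show ?thesis
        by (simp add: add.commute)
    qed
    ultimately have "h (Suc i) * (real i / real (i + 1)) + 1 / n \<le> B"
      by linarith
    then show ?thesis
      using h_le[of "Suc i"] i False by (simp add: h_def)
  qed
  have "0 \<le> h n"
    using M unfolding h_def B_def by (auto simp: field_simps)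
  then have "(\<Sum>i<n. real (i + 1) / n * q i) \<le> h 0"
    using step by (intro secretary_lp_bound q0 q) blast+
  also have "h 0 \<le> B"
    by (rule h_le) simp
  finally show ?thesis
    by (simp add: B_def M_def)
qed

section \<open>Winning probability within one phase\<close>

lemma first_accepted_eq_Some_iff:
  "first_accepted P acc = Some t \<longleftrightarrow> t \<in> P \<and> acc t \<and> (\<forall>s\<in>P. s < t \<longrightarrow> \<not> acc s)"
proof
  assume *: "first_accepted P acc = Some t"
  then have ex: "\<exists>s. s \<in> P \<and> acc s" and t: "t = (LEAST s. s \<in> P \<and> acc s)"
    unfolding first_accepted_def by (auto split: if_splits)
  show "t \<in> P \<and> acc t \<and> (\<forall>s\<in>P. s < t \<longrightarrow> \<not> acc s)"
    using LeastI_ex[OF ex] not_less_Least[of _ "\<lambda>s. s \<in> P \<and> acc s"] unfolding t[symmetric]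
    by blast
next
  assume *: "t \<in> P \<and> acc t \<and> (\<forall>s\<in>P. s < t \<longrightarrow> \<not> acc s)"
  then have "(LEAST s. s \<in> P \<and> acc s) = t"
    by (intro Least_equality) (auto intro: leI)
  then show "first_accepted P acc = Some t"
    using * unfolding first_accepted_def by auto
qed

lemma perm_count_mono:
  assumes "\<And>\<sigma>. \<sigma> permutes {..<N} \<Longrightarrow> E \<sigma> \<Longrightarrow> F \<sigma>"
  shows "perm_count N E \<le> perm_count N F"
  unfolding perm_count_def by (rule card_mono) (use assms in auto)

lemma perm_count_add_le:
  assumes "\<And>\<sigma>. \<sigma> permutes {..<N} \<Longrightarrow> E \<sigma> \<or> F \<sigma> \<Longrightarrow> G \<sigma>"
    and "\<And>\<sigma>. \<sigma> permutes {..<N} \<Longrightarrow> \<not> (E \<sigma> \<and> F \<sigma>)"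
  shows "perm_count N E + perm_count N F \<le> perm_count N G"
proof -
  have "perm_count N E + perm_count N F =
      card ({\<sigma>. \<sigma> permutes {..<N} \<and> E \<sigma>} \<union> {\<sigma>. \<sigma> permutes {..<N} \<and> F \<sigma>})"
    unfolding perm_count_def using assms(2) by (intro card_Un_disjoint[symmetric]) auto
  also have "\<dots> \<le> perm_count N G"
    unfolding perm_count_def by (rule card_mono) (use assms(1) in auto)
  finally show ?thesis .
qed

lemma perm_count_True: "perm_count N (\<lambda>\<sigma>. True) = fact N"
  unfolding perm_count_def by (simp add: card_permutations)

text \<open>Serves both phases, \<open>m\<close> being the first position of the phase. As
  acceptance at \<open>t\<close> depends only on the order on \<open>{m..t}\<close>, the rule plays
  a secretary problem there, and the normalized counts \<open>Q i / fact N\<close> are feasible for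
  the linear program. The factor \<open>n / N\<close> is the chance that item 0 falls into the
  phase.\<close>

lemma phase_win_bound:
  assumes n: "3 \<le> n" "m + n \<le> N"
    and acc: "\<And>t. t \<in> {m..<m + n} \<Longrightarrow> order_determined N {m..t} (\<lambda>\<sigma>. acc \<sigma> t)"
  shows "N * real (perm_count N (\<lambda>\<sigma>. \<exists>t. first_accepted {m..<m + n} (acc \<sigma>) = Some t \<and> \<sigma> t = 0))
    \<le> n * fact N * (1 / exp 1 + 2 / (real n - 1))"
proof -
  define G where "G i \<sigma> \<longleftrightarrow> first_accepted {m..<m + n} (acc \<sigma>) = Some (m + i)" for i \<sigma>
  define U where "U i \<sigma> \<longleftrightarrow> (\<forall>t\<in>{m..<m + i}. \<not> acc \<sigma> t)" for i \<sigma>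
  define Q where "Q i = perm_count N (\<lambda>\<sigma>. G i \<sigma> \<and> (\<forall>s\<in>{m..m + i}. \<sigma> (m + i) \<le> \<sigma> s))" for i
  have G_iff: "G i \<sigma> \<longleftrightarrow> acc \<sigma> (m + i) \<and> U i \<sigma>" if "i < n" for i \<sigma>
    using that unfolding G_def U_def first_accepted_eq_Some_iff by auto
  have U_det: "order_determined N {m..<m + i} (U i)" if "i \<le> n" for i
    unfolding U_def using that
    by (intro order_determined_all order_determined_not order_determined_mono[OF acc]) auto
  have G_det: "order_determined N {m..m + i} (G i)" if "i < n" for i
  proof -
    have "order_determined N {m..m + i} (\<lambda>\<sigma>. acc \<sigma> (m + i) \<and> U i \<sigma>)"
      using that by (intro order_determined_conj acc order_determined_mono[OF U_det]) auto
    then show ?thesis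
      using G_iff[OF that] by presburger
  qed
  \<comment> \<open>Acceptance at \<open>m + i\<close> is dropped, keeping only \<open>U i\<close>:
    this event depends on the earlier positions alone and is therefore independent of
    \<open>m + i\<close> being a new minimum.\<close>
  have Q_U: "(i + 1) * Q i \<le> perm_count N (U i)" if "i < n" for i
  proof -
    have "Q i \<le> perm_count N (\<lambda>\<sigma>. U i \<sigma> \<and> (\<forall>s\<in>{m..<m + i}. \<sigma> (m + i) < \<sigma> s))"
      unfolding Q_def
    proof (rule perm_count_mono)
      fix \<sigma> assume \<sigma>: "\<sigma> permutes {..<N}"
        and *: "G i \<sigma> \<and> (\<forall>s\<in>{m..m + i}. \<sigma> (m + i) \<le> \<sigma> s)"
      have "\<sigma> (m + i) < \<sigma> s" if s: "s \<in> {m..<m + i}" for s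
      proof -
        have "\<sigma> (m + i) \<noteq> \<sigma> s"
          using permutes_inj[OF \<sigma>] s by (auto dest: injD)
        moreover have "\<sigma> (m + i) \<le> \<sigma> s"
          using * s by auto
        ultimately show ?thesis by simp
      qed
      then show "U i \<sigma> \<and> (\<forall>s\<in>{m..<m + i}. \<sigma> (m + i) < \<sigma> s)"
        using * G_iff[OF \<open>i < n\<close>] by auto
    qed
    then have "(i + 1) * Q i \<le>
        (i + 1) * perm_count N (\<lambda>\<sigma>. U i \<sigma> \<and> (\<forall>s\<in>{m..<m + i}. \<sigma> (m + i) < \<sigma> s))"
      by (rule mult_le_mono2)
    moreover have "{m..<m + i} \<subseteq> {..<N}"
      using that n by auto
    ultimately show ?thesis
      using perm_count_new_min[OF U_det[of i], of "m + i"] that n by simp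
  qed
  \<comment> \<open>\<open>U (Suc i)\<close> and the event counted by \<open>Q i\<close> are
    disjoint parts of \<open>U i\<close>. Acceptances of items that are not best so far are lost,
    hence only an inequality.\<close>
  have U_Q: "perm_count N (U i) + (\<Sum>j<i. Q j) \<le> fact N" if "i \<le> n" for i
    using that
  proof (induction i)
    case 0
    then show ?case
      using perm_count_mono[of N "U 0" "\<lambda>_. True"] by (simp add: perm_count_True)
  next
    case (Suc i)
    have "perm_count N (U (Suc i)) + Q i \<le> perm_count N (U i)"
      unfolding Q_def
      by (rule perm_count_add_le) (use Suc.prems G_iff[of i] in \<open>auto simp: U_def\<close>)
    then show ?case
      using Suc by simp
  qed
  define q where "q i = Q i / fact N" for i
  have "(\<Sum>i<n. real (i + 1) / n * q i) \<le> 1 / exp 1 + 2 / (real n - 1)"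
  proof (rule secretary_lp[OF n(1)])
    show "0 \<le> q i" for i
      unfolding q_def by simp
    show "real (i + 1) * q i \<le> 1 - (\<Sum>j<i. q j)" if "i < n" for i
    proof -
      have "(i + 1) * Q i + (\<Sum>j<i. Q j) \<le> fact N"
        using Q_U[OF that] U_Q[of i] that by linarith
      then have "real ((i + 1) * Q i + (\<Sum>j<i. Q j)) \<le> real (fact N)"
        by (simp only: of_nat_le_iff)
      then have "real (i + 1) * Q i + (\<Sum>j<i. real (Q j)) \<le> fact N"
        by (simp only: of_nat_add of_nat_mult of_nat_sum of_nat_fact)
      then have "(real (i + 1) * Q i + (\<Sum>j<i. real (Q j))) / fact N \<le> fact N / fact N"
        by (rule divide_right_mono) simp
      then show ?thesis
        unfolding q_def by (simp add: add_divide_distrib sum_divide_distrib)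
    qed
  qed
  then have lp: "n * fact N * (\<Sum>i<n. real (i + 1) / n * q i) \<le>
      n * fact N * (1 / exp 1 + 2 / (real n - 1))"
    by (rule mult_left_mono) simp
  have "perm_count N (\<lambda>\<sigma>. \<exists>t. first_accepted {m..<m + n} (acc \<sigma>) = Some t \<and> \<sigma> t = 0) \<le>
      card (\<Union>i\<in>{..<n}. {\<sigma>. \<sigma> permutes {..<N} \<and> G i \<sigma> \<and> \<sigma> (m + i) = 0})"
    unfolding perm_count_def
  proof (rule card_mono)
    show "{\<sigma>. \<sigma> permutes {..<N} \<and> (\<exists>t. first_accepted {m..<m + n} (acc \<sigma>) = Some t \<and> \<sigma> t = 0)}
      \<subseteq> (\<Union>i\<in>{..<n}. {\<sigma>. \<sigma> permutes {..<N} \<and> G i \<sigma> \<and> \<sigma> (m + i) = 0})"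
    proof clarify
      fix \<sigma> t
      assume \<sigma>: "\<sigma> permutes {..<N}" "first_accepted {m..<m + n} (acc \<sigma>) = Some t" "\<sigma> t = 0"
      then have "t \<in> {m..<m + n}"
        by (simp add: first_accepted_eq_Some_iff)
      then show "\<sigma> \<in> (\<Union>i\<in>{..<n}. {\<sigma>. \<sigma> permutes {..<N} \<and> G i \<sigma> \<and> \<sigma> (m + i) = 0})"
        using \<sigma> unfolding G_def by (intro UN_I[of "t - m"]) auto
    qed
  qed simp
  also have "\<dots> \<le> (\<Sum>i<n. perm_count N (\<lambda>\<sigma>. G i \<sigma> \<and> \<sigma> (m + i) = 0))"
    unfolding perm_count_def by (rule card_UN_le) simp
  finally have "N * perm_count N (\<lambda>\<sigma>. \<exists>t. first_accepted {m..<m + n} (acc \<sigma>) = Some t \<and> \<sigma> t = 0) \<le>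
      N * (\<Sum>i<n. perm_count N (\<lambda>\<sigma>. G i \<sigma> \<and> \<sigma> (m + i) = 0))"
    by (rule mult_le_mono2)
  also have "\<dots> = (\<Sum>i<n. N * perm_count N (\<lambda>\<sigma>. G i \<sigma> \<and> \<sigma> (m + i) = 0))"
    by (rule sum_distrib_left)
  \<comment> \<open>\<open>perm_count_top\<close> is used with \<open>S = {m..m + i}\<close>, which
    has \<open>i + 1\<close> elements; this produces the weights of the linear program.\<close>
  also have "\<dots> = (\<Sum>i<n. (i + 1) * Q i)"
  proof (rule sum.cong)
    fix i assume i: "i \<in> {..<n}"
    then have "{m..m + i} \<subseteq> {..<N}"
      using n by auto
    then show "N * perm_count N (\<lambda>\<sigma>. G i \<sigma> \<and> \<sigma> (m + i) = 0) = (i + 1) * Q i"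
      unfolding Q_def using perm_count_top[OF G_det[of i], of "m + i"] i by simp
  qed simp
  finally have "real (N * perm_count N (\<lambda>\<sigma>. \<exists>t. first_accepted {m..<m + n} (acc \<sigma>) = Some t \<and> \<sigma> t = 0))
      \<le> real (\<Sum>i<n. (i + 1) * Q i)"
    by (simp only: of_nat_le_iff)
  also have "\<dots> = n * fact N * (\<Sum>i<n. real (i + 1) / n * q i)"
    unfolding sum_distrib_left of_nat_sum q_def using n by (intro sum.cong) (auto simp: distrib_right)
  finally show ?thesis
    using lp by simp
qed

section \<open>The hard instance\<close>

text \<open>
  A single valuable item and otherwise small items.  The small values have to be distinct: ties
  among them could be broken in a way that tells where the valuable item is.
\<close>

definition geometric_instance :: "nat \<Rightarrow> real list" where
  "geometric_instance n = map (\<lambda>i. (1 / real n) ^ i) [0..<2 * n]"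

lemma nth_geometric_instance: "i < 2 * n \<Longrightarrow> geometric_instance n ! i = (1 / real n) ^ i"
  unfolding geometric_instance_def by simp

lemma rpi_instance_geometric: "1 \<le> n \<Longrightarrow> rpi_instance n (geometric_instance n)"
  unfolding rpi_instance_def geometric_instance_def
  by (auto simp: sorted_wrt_iff_nth_less intro!: power_decreasing)

definition value_order :: "nat \<Rightarrow> (nat \<Rightarrow> nat) \<Rightarrow> nat rel" where
  "value_order N \<sigma> = {(s, t). s < N \<and> t < N \<and> \<sigma> s \<le> \<sigma> t}"

text \<open>For \<open>n \<ge> 2\<close> the values strictly decrease with the label, so no ties
  occur and a valid rule has no freedom. Antisymmetry excludes any further pairs.\<close>

lemma tie_rule_geometric:
  assumes T: "valid_tie_rule T" and n: "2 \<le> n" and \<sigma>: "\<sigma> permutes {..<2 * n}"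
  shows "T (geometric_instance n) \<sigma> = value_order (2 * n) \<sigma>"
proof -
  let ?R = "T (geometric_instance n) \<sigma>"
  have "rpi_instance n (geometric_instance n)"
    using n by (simp add: rpi_instance_geometric)
  then have lin: "linear_order_on {..<2 * n} ?R"
    and val: "\<And>s t. s < 2 * n \<Longrightarrow> t < 2 * n \<Longrightarrow>
      geometric_instance n ! \<sigma> s > geometric_instance n ! \<sigma> t \<Longrightarrow> (s, t) \<in> ?R"
    using T \<sigma> unfolding valid_tie_rule_def by blast+
  have less: "(s, t) \<in> ?R" if "s < 2 * n" "t < 2 * n" "\<sigma> s < \<sigma> t" for s t
  proof (rule val[OF that(1,2)])
    have "\<sigma> s < 2 * n" "\<sigma> t < 2 * n"
      using permutes_in_image[OF \<sigma>] that by auto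
    then show "geometric_instance n ! \<sigma> s > geometric_instance n ! \<sigma> t"
      using that(3) n by (simp add: nth_geometric_instance power_strict_decreasing)
  qed
  have R: "?R \<subseteq> {..<2 * n} \<times> {..<2 * n}" "refl_on {..<2 * n} ?R" "antisym ?R"
    using lin unfolding linear_order_on_def partial_order_on_def preorder_on_def by auto
  show ?thesis
  proof (intro equalityI subrelI)
    fix s t assume st: "(s, t) \<in> ?R"
    then have "s < 2 * n" "t < 2 * n"
      using R(1) by auto
    moreover have "\<sigma> s \<le> \<sigma> t"
    proof (rule ccontr)
      assume "\<not> \<sigma> s \<le> \<sigma> t"
      moreover from this have "(t, s) \<in> ?R"
        using less \<open>s < 2 * n\<close> \<open>t < 2 * n\<close> by simp
      ultimately show False
        using st R(3) by (metis antisymD le_refl)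
    qed
    ultimately show "(s, t) \<in> value_order (2 * n) \<sigma>"
      by (simp add: value_order_def)
  next
    fix s t assume "(s, t) \<in> value_order (2 * n) \<sigma>"
    then have st: "s < 2 * n" "t < 2 * n" "\<sigma> s \<le> \<sigma> t"
      by (auto simp: value_order_def)
    show "(s, t) \<in> ?R"
    proof (cases "s = t")
      case True
      then show ?thesis
        using R(2) st by (simp add: refl_on_def)
    next
      case False
      then have "\<sigma> s \<noteq> \<sigma> t"
        using permutes_inj[OF \<sigma>] by (auto dest: injD)
      then show ?thesis
        using less st by simp
    qed
  qed
qed

section \<open>Decisions as events of the relative order\<close>

lemma linear_order_on_Restr_value_order:
  assumes "\<sigma> permutes {..<N}" "A \<subseteq> {..<N}"
  shows "linear_order_on A (Restr (value_order N \<sigma>) A)"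
  unfolding linear_order_on_def partial_order_on_def preorder_on_def
proof (intro conjI)
  show "antisym (Restr (value_order N \<sigma>) A)"
  proof (rule antisymI)
    fix s t
    assume "(s, t) \<in> Restr (value_order N \<sigma>) A" "(t, s) \<in> Restr (value_order N \<sigma>) A"
    then have "\<sigma> s = \<sigma> t"
      by (simp add: value_order_def)
    then show "s = t"
      using permutes_inj[OF assms(1)] by (simp add: inj_eq)
  qed
  show "refl_on A (Restr (value_order N \<sigma>) A)"
    using assms(2) by (auto simp: refl_on_def value_order_def)
  show "trans (Restr (value_order N \<sigma>) A)"
    by (auto simp: trans_def value_order_def)
  show "total_on A (Restr (value_order N \<sigma>) A)"
    using assms(2) by (auto simp: total_on_def value_order_def)
qed auto

lemma phase1_order_determined:
  assumes "t < N"
  shows "order_determined N {0..t} (\<lambda>\<sigma>. d (Restr (value_order N \<sigma>) {..t}))"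
  unfolding order_determined_def
proof (intro allI impI)
  fix \<sigma> \<tau> :: "nat \<Rightarrow> nat"
  assume "\<forall>s\<in>{0..t}. \<forall>r\<in>{0..t}. \<sigma> s \<le> \<sigma> r \<longleftrightarrow> \<tau> s \<le> \<tau> r"
  then have "Restr (value_order N \<sigma>) {..t} = Restr (value_order N \<tau>) {..t}"
    by (auto simp: value_order_def)
  then show "d (Restr (value_order N \<sigma>) {..t}) \<Longrightarrow> d (Restr (value_order N \<tau>) {..t})"
    by simp
qed

text \<open>Brings the revealed part of Phase 1 into the form that \<open>phase2_observation\<close>
  asks for; if nothing is accepted, \<open>a = n\<close>.\<close>

lemma phase1_revealed_eq:
  assumes "1 \<le> n"
  shows "\<exists>a. 1 \<le> a \<and> a \<le> n \<and> phase1_revealed n d R = {..<a}"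
proof (cases "phase1_choice n d R")
  case None
  then show ?thesis
    using assms unfolding phase1_revealed_def by auto
next
  case (Some t)
  then have "t < n"
    unfolding phase1_choice_def by (simp add: first_accepted_eq_Some_iff)
  then show ?thesis
    using Some unfolding phase1_revealed_def by (intro exI[of _ "Suc t"]) (auto simp: lessThan_Suc_atMost)
qed

text \<open>The stopping time of Phase 1 may differ between the two permutations, so the full
  observations may differ too. Both are possible Phase 2 observations with the same restriction to
  Phase 2, and there the hypothesis on \<open>d\<close> forces the same decision.\<close>

lemma phase2_order_determined:
  assumes d: "rule_ignores_phase1 n d" and t: "n \<le> t" "t < 2 * n"
  shows "order_determined (2 * n) {n..t}
    (\<lambda>\<sigma>. d (Restr (value_order (2 * n) \<sigma>) (phase1_revealed n d (value_order (2 * n) \<sigma>) \<union> {n..t})))"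
  unfolding order_determined_def
proof (intro allI impI)
  fix \<sigma> \<tau> :: "nat \<Rightarrow> nat"
  assume perm: "\<sigma> permutes {..<2 * n}" "\<tau> permutes {..<2 * n}"
    and eq: "\<forall>s\<in>{n..t}. \<forall>r\<in>{n..t}. \<sigma> s \<le> \<sigma> r \<longleftrightarrow> \<tau> s \<le> \<tau> r"
  define Obs where "Obs \<rho> =
    Restr (value_order (2 * n) \<rho>) (phase1_revealed n d (value_order (2 * n) \<rho>) \<union> {n..t})" for \<rho>
  have Obs: "phase2_observation n (Obs \<rho>)"
      "Restr (Obs \<rho>) {n..<2 * n} = Restr (value_order (2 * n) \<rho>) {n..t}"
    if \<rho>: "\<rho> permutes {..<2 * n}" for \<rho>
  proof -
    obtain a where a: "1 \<le> a" "a \<le> n" "phase1_revealed n d (value_order (2 * n) \<rho>) = {..<a}"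
      using phase1_revealed_eq[of n d "value_order (2 * n) \<rho>"] t by auto
    then have "linear_order_on ({..<a} \<union> {n..t}) (Obs \<rho>)"
      unfolding Obs_def a(3) using t by (intro linear_order_on_Restr_value_order \<rho>) auto
    then show "phase2_observation n (Obs \<rho>)"
      using a t unfolding phase2_observation_def by blast
    show "Restr (Obs \<rho>) {n..<2 * n} = Restr (value_order (2 * n) \<rho>) {n..t}"
    proof -
      have "({..<a} \<union> {n..t}) \<inter> {n..<2 * n} = {n..t}"
        using a(1,2) t by auto
      then show ?thesis
        unfolding Obs_def a(3) by blast
    qed
  qed
  have "Restr (value_order (2 * n) \<sigma>) {n..t} = Restr (value_order (2 * n) \<tau>) {n..t}"
    using eq by (auto simp: value_order_def)
  then have "d (Obs \<sigma>) = d (Obs \<tau>)"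
    using d Obs perm unfolding rule_ignores_phase1_def by metis
  then show "d (Restr (value_order (2 * n) \<sigma>) (phase1_revealed n d (value_order (2 * n) \<sigma>) \<union> {n..t})) \<Longrightarrow>
      d (Restr (value_order (2 * n) \<tau>) (phase1_revealed n d (value_order (2 * n) \<tau>) \<union> {n..t}))"
    unfolding Obs_def by simp
qed

section \<open>Algorithm and prophet on the hard instance\<close>

text \<open>Item 0 is worth 1 and every other item at most \<open>1 / n\<close>, so up to this error
  the value of a phase is the indicator of winning.\<close>

lemma accepted_value_geometric:
  assumes n: "1 \<le> n" and \<sigma>: "\<sigma> permutes {..<2 * n}" and c: "\<And>t. c = Some t \<Longrightarrow> t < 2 * n"
  shows "0 \<le> accepted_value (geometric_instance n) \<sigma> c"
    and "accepted_value (geometric_instance n) \<sigma> c \<le>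
      of_bool (\<exists>t. c = Some t \<and> \<sigma> t = 0) + 1 / n"
proof -
  have val: "geometric_instance n ! \<sigma> t = (1 / real n) ^ \<sigma> t" if "c = Some t" for t
    using c[OF that] permutes_in_image[OF \<sigma>, of t] by (simp add: nth_geometric_instance)
  then show "0 \<le> accepted_value (geometric_instance n) \<sigma> c"
    unfolding accepted_value_def by (auto split: option.split)
  show "accepted_value (geometric_instance n) \<sigma> c \<le>
      of_bool (\<exists>t. c = Some t \<and> \<sigma> t = 0) + 1 / n"
  proof (cases c)
    case (Some t)
    have "(1 / real n) ^ \<sigma> t \<le> (1 / real n) ^ 1" if "\<sigma> t \<noteq> 0"
      by (rule power_decreasing) (use that n in auto)
    then show ?thesis
      using val[OF Some] Some by (auto simp: accepted_value_def)
  qed (simp add: accepted_value_def)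
qed

lemma expectation_arrival_order:
  "measure_pmf.expectation (arrival_order n) f =
    (\<Sum>\<sigma> | \<sigma> permutes {..<2 * n}. f \<sigma>) / fact (2 * n)" for f :: "_ \<Rightarrow> real"
proof -
  have "{\<sigma>. \<sigma> permutes {..<2 * n}} \<noteq> {}"
    using permutes_id by blast
  then show ?thesis
    unfolding arrival_order_def by (subst integral_pmf_of_set) (auto simp: card_permutations finite_permutations)
qed

lemma set_pmf_arrival_order: "set_pmf (arrival_order n) = {\<sigma>. \<sigma> permutes {..<2 * n}}"
proof -
  have "{\<sigma>. \<sigma> permutes {..<2 * n}} \<noteq> {}"
    using permutes_id by blast
  then show ?thesis
    unfolding arrival_order_def by (intro set_pmf_of_set) (auto simp: finite_permutations)
qed

lemma sum_of_bool_perm_count: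
  "(\<Sum>\<sigma> | \<sigma> permutes {..<N}. of_bool (E \<sigma>)) = real (perm_count N E)"
  unfolding perm_count_def by (simp add: sum_of_bool_eq finite_permutations Collect_conj_eq)

lemma total_value_geometric_bounds:
  assumes "valid_tie_rule T" "3 \<le> n" "\<sigma> permutes {..<2 * n}"
  defines "R \<equiv> value_order (2 * n) \<sigma>"
  shows "0 \<le> total_value T n (geometric_instance n) d \<sigma>"
    and "total_value T n (geometric_instance n) d \<sigma> \<le>
      of_bool (\<exists>t. phase1_choice n d R = Some t \<and> \<sigma> t = 0) +
      of_bool (\<exists>t. phase2_choice n d R = Some t \<and> \<sigma> t = 0) + 2 / n"
proof -
  have n: "1 \<le> n"
    using assms by simp
  have "t < 2 * n" if "phase1_choice n d R = Some t" for t
    using that unfolding phase1_choice_def by (simp add: first_accepted_eq_Some_iff)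
  note 1 = accepted_value_geometric[where c = "phase1_choice n d R", OF n assms(3) this]
  have "t < 2 * n" if "phase2_choice n d R = Some t" for t
    using that unfolding phase2_choice_def by (simp add: first_accepted_eq_Some_iff)
  note 2 = accepted_value_geometric[where c = "phase2_choice n d R", OF n assms(3) this]
  have T: "T (geometric_instance n) \<sigma> = R"
    unfolding R_def using assms by (intro tie_rule_geometric) auto
  show "0 \<le> total_value T n (geometric_instance n) d \<sigma>"
    unfolding total_value_def T by (intro add_nonneg_nonneg 1 2)
  show "total_value T n (geometric_instance n) d \<sigma> \<le>
      of_bool (\<exists>t. phase1_choice n d R = Some t \<and> \<sigma> t = 0) +
      of_bool (\<exists>t. phase2_choice n d R = Some t \<and> \<sigma> t = 0) + 2 / n"
    using 1(2) 2(2) unfolding total_value_def T by simp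
qed

text \<open>Each phase has half of the positions, so it wins with probability at most half of the
  secretary bound; the two halves add up. The small items contribute at most \<open>1 / n\<close>
  per phase.\<close>

lemma expectation_total_value_geometric:
  assumes T: "valid_tie_rule T" and n: "3 \<le> n" and d: "rule_ignores_phase1 n d"
  shows "measure_pmf.expectation (arrival_order n) (total_value T n (geometric_instance n) d) \<le>
    1 / exp 1 + 2 / (real n - 1) + 2 / n"
proof -
  let ?N = "2 * n"
  define B where "B = 1 / exp 1 + 2 / (real n - 1)"
  let ?R = "value_order ?N"
  have half: "x \<le> fact ?N * B / 2" if "real ?N * x \<le> real (n * fact ?N) * B" for x
  proof -
    have "real n * (2 * x) \<le> real n * (fact ?N * B)"
      using that by (simp add: mult_ac)
    then show ?thesis
      using n by simp
  qed
  define W1 where "W1 \<sigma> \<longleftrightarrow> (\<exists>t. phase1_choice n d (?R \<sigma>) = Some t \<and> \<sigma> t = 0)" for \<sigma>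
  define W2 where "W2 \<sigma> \<longleftrightarrow> (\<exists>t. phase2_choice n d (?R \<sigma>) = Some t \<and> \<sigma> t = 0)" for \<sigma>
  have "?N * real (perm_count ?N W1) \<le> n * fact ?N * B"
    using phase_win_bound[OF n, of 0 ?N "\<lambda>\<sigma> t. d (Restr (?R \<sigma>) {..t})"] phase1_order_determined n
    by (simp add: W1_def[abs_def] B_def phase1_choice_def atLeast0LessThan)
  then have W1: "perm_count ?N W1 \<le> fact ?N * B / 2"
    by (rule half)
  have interval: "{n..<n + n} = {n..<?N}"
    by auto
  have "?N * real (perm_count ?N W2) \<le> n * fact ?N * B"
    using phase_win_bound[OF n, of n ?N
        "\<lambda>\<sigma> t. d (Restr (?R \<sigma>) (phase1_revealed n d (?R \<sigma>) \<union> {n..t}))", unfolded interval]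
      phase2_order_determined[OF d] n
    by (simp add: W2_def[abs_def] B_def phase2_choice_def)
  then have W2: "perm_count ?N W2 \<le> fact ?N * B / 2"
    by (rule half)
  have "(\<Sum>\<sigma> | \<sigma> permutes {..<?N}. total_value T n (geometric_instance n) d \<sigma>) \<le>
      (\<Sum>\<sigma> | \<sigma> permutes {..<?N}. of_bool (W1 \<sigma>) + of_bool (W2 \<sigma>) + 2 / real n)"
    unfolding W1_def W2_def by (intro sum_mono total_value_geometric_bounds(2) T n) simp
  also have "\<dots> = perm_count ?N W1 + perm_count ?N W2 + fact ?N * (2 / n)"
    by (simp add: sum.distrib sum_of_bool_perm_count card_permutations)
  also have "\<dots> \<le> fact ?N * (B + 2 / n)"
    using W1 W2 by (simp add: distrib_left)
  finally show ?thesis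
    unfolding expectation_arrival_order B_def[symmetric]
    by (simp add: pos_divide_le_eq mult.commute)
qed

text \<open>The bound holds for every rule in the support and hence survives averaging over the
  random rule.\<close>

lemma expected_value_geometric:
  assumes T: "valid_tie_rule T" and n: "3 \<le> n" and ALG: "does_not_compare ALG"
  shows "expected_value T ALG n (geometric_instance n) \<le> 1 / exp 1 + 2 / (real n - 1) + 2 / n"
proof -
  let ?v = "geometric_instance n"
  let ?D = "rule_distribution ALG n ?v"
  let ?B = "1 / exp 1 + 2 / (real n - 1) + 2 / n"
  have B: "0 \<le> ?B"
    using n by simp
  have ignores: "rule_ignores_phase1 n d" if "d \<in> set_pmf ?D" for d
    using ALG that rpi_instance_geometric[of n] n unfolding does_not_compare_def by auto
  \<comment> \<open>The distribution of rules may have infinite support. Nonnegative integrals allow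
    iterating over rule and order without an integrability proof for the pair.\<close>
  have "(\<integral>\<^sup>+\<sigma>. total_value T n ?v d \<sigma> \<partial>arrival_order n) \<le> ?B" if "d \<in> set_pmf ?D" for d
  proof -
    have "(\<integral>\<^sup>+\<sigma>. total_value T n ?v d \<sigma> \<partial>arrival_order n) =
        measure_pmf.expectation (arrival_order n) (total_value T n ?v d)"
    proof (rule nn_integral_eq_integral)
      show "integrable (arrival_order n) (total_value T n ?v d)"
        by (rule integrable_measure_pmf_finite) (simp add: set_pmf_arrival_order finite_permutations)
      show "AE \<sigma> in arrival_order n. 0 \<le> total_value T n ?v d \<sigma>"
        using total_value_geometric_bounds(1)[OF T n]
        by (auto simp: AE_measure_pmf_iff set_pmf_arrival_order)
    qed
    also have "\<dots> \<le> ?B"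
      by (intro ennreal_leI expectation_total_value_geometric T n ignores that)
    finally show ?thesis .
  qed
  then have "(\<integral>\<^sup>+d. (\<integral>\<^sup>+\<sigma>. total_value T n ?v d \<sigma> \<partial>arrival_order n) \<partial>?D) \<le>
      (\<integral>\<^sup>+d. ?B \<partial>?D)"
    by (intro nn_integral_mono_AE) (simp add: AE_measure_pmf_iff)
  also have "\<dots> = ?B"
    by simp
  finally show ?thesis
    unfolding expected_value_def
    by (intro integral_real_bounded B) (simp add: nn_integral_pair_pmf')
qed

text \<open>Item 0 has value 1 and lies in one of the phases, while the maximum of the other phase
  is nonnegative. With a denominator of at least 1, bounding the expected value bounds the
  ratio.\<close>

lemma expected_prophet_geometric:
  assumes n: "1 \<le> n"
  shows "1 \<le> expected_prophet n (geometric_instance n)"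
proof -
  let ?v = "geometric_instance n"
  have "1 \<le> Max ((\<lambda>i. ?v ! \<sigma> i) ` {..<n}) + Max ((\<lambda>i. ?v ! \<sigma> i) ` {n..<2 * n})"
    if \<sigma>: "\<sigma> permutes {..<2 * n}" for \<sigma>
  proof -
    have nonneg: "0 \<le> ?v ! \<sigma> i" if "i < 2 * n" for i
      using that permutes_in_image[OF \<sigma>, of i] by (simp add: nth_geometric_instance)
    have Max_ge: "x \<le> Max ((\<lambda>i. ?v ! \<sigma> i) ` I)" if "i \<in> I" "finite I" "x \<le> ?v ! \<sigma> i" for i I x
      using that by (meson Max_ge finite_imageI image_eqI order_trans)
    have nonneg1: "0 \<le> Max ((\<lambda>i. ?v ! \<sigma> i) ` {..<n})"
      using n by (intro Max_ge[of 0] nonneg) auto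
    have nonneg2: "0 \<le> Max ((\<lambda>i. ?v ! \<sigma> i) ` {n..<2 * n})"
      using n by (intro Max_ge[of n] nonneg) auto
    have "0 \<in> \<sigma> ` {..<2 * n}"
      using n permutes_image[OF \<sigma>] by simp
    then obtain t where t: "t < 2 * n" "\<sigma> t = 0"
      by auto
    then have vt: "1 \<le> ?v ! \<sigma> t"
      using n by (simp add: nth_geometric_instance)
    show ?thesis
    proof (cases "t < n")
      case True
      then have "1 \<le> Max ((\<lambda>i. ?v ! \<sigma> i) ` {..<n})"
        by (intro Max_ge[of t] vt) auto
      then show ?thesis
        using nonneg2 by linarith
    next
      case False
      then have "1 \<le> Max ((\<lambda>i. ?v ! \<sigma> i) ` {n..<2 * n})"
        using t by (intro Max_ge[of t] vt) auto
      then show ?thesis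
        using nonneg1 by linarith
    qed
  qed
  then have "(\<Sum>\<sigma> | \<sigma> permutes {..<2 * n}. 1) \<le> (\<Sum>\<sigma> | \<sigma> permutes {..<2 * n}.
      Max ((\<lambda>i. ?v ! \<sigma> i) ` {..<n}) + Max ((\<lambda>i. ?v ! \<sigma> i) ` {n..<2 * n}))"
    by (intro sum_mono) simp
  then show ?thesis
    unfolding expected_prophet_def expectation_arrival_order
    by (simp add: card_permutations field_simps)
qed

theorem lemma2p2:
  fixes T :: tie_rule and ALG :: algorithm
  assumes "valid_tie_rule T"
    and "does_not_compare ALG"
  shows "perf T ALG \<le> ereal (1 / exp 1)"
proof -
  let ?B = "\<lambda>n. 1 / exp 1 + 2 / (real n - 1) + 2 / n"
  have "(INF v \<in> {v. rpi_instance n v \<and> (\<exists>x\<in>set v. x \<noteq> 0)}.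
      ereal (expected_value T ALG n v / expected_prophet n v)) \<le> ereal (?B n)" if n: "3 \<le> n" for n
  \<comment> \<open>The witness depends on \<open>n\<close> only and not on the algorithm, so
    knowing the values in advance does not help; both variants are covered at once.\<close>
  proof (rule INF_lower2)
    let ?v = "geometric_instance n"
    have "?v ! 0 \<in> set ?v"
      by (rule nth_mem) (use n in \<open>simp add: geometric_instance_def\<close>)
    moreover have "?v ! 0 \<noteq> 0"
      using n by (simp add: nth_geometric_instance)
    ultimately show "?v \<in> {v. rpi_instance n v \<and> (\<exists>x\<in>set v. x \<noteq> 0)}"
      using n rpi_instance_geometric[of n] by auto
    have "1 \<le> expected_prophet n ?v"
      using n by (intro expected_prophet_geometric) simp
    moreover have "expected_value T ALG n ?v \<le> ?B n * 1"
      using expected_value_geometric[OF assms(1) n assms(2)] by simp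
    moreover have "?B n * 1 \<le> ?B n * expected_prophet n ?v"
      using calculation(1) n by (intro mult_left_mono) auto
    ultimately have "expected_value T ALG n ?v / expected_prophet n ?v \<le> ?B n"
      by (subst pos_divide_le_eq) linarith+
    then show "ereal (expected_value T ALG n ?v / expected_prophet n ?v) \<le> ereal (?B n)"
      by simp
  qed
  \<comment> \<open>The bound for \<open>n \<ge> 3\<close> suffices, as the limit inferior ignores
    finitely many terms.\<close>
  then have "perf T ALG \<le> liminf (\<lambda>n. ereal (?B n))"
    unfolding perf_def by (intro Liminf_mono) (auto simp: eventually_sequentially)
  also have "liminf (\<lambda>n. ereal (?B n)) = ereal (1 / exp 1)"
  proof (rule lim_imp_Liminf)
    have "?B \<longlonglongrightarrow> 1 / exp 1"
      by real_asymp
    then show "(\<lambda>n. ereal (?B n)) \<longlonglongrightarrow> ereal (1 / exp 1)"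
      by simp
  qed simp
  finally show ?thesis .
qed

end
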